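(* Let $G=(V,E)$ be a finite graph, with multiple edges and loops allowed, whose edge set $E$ is linearly ordered, and let $\mathcal{B}_G$ be its broken circuit complex with respect to this order. Then $$A_G(V)=\sum_{S\in\mathcal{B}_G}\ \prod_{C\in\mathcal{C}(S)}v_C .$$
   Context: Graphs are finite and may have multiple edges and loops. An orientation of $G$ assigns a direction to each edge; it is acyclic if it has no directed cycles (so a graph with a loop has no acyclic orientation). $\mathcal{A}(G)$ is the set of acyclic orientations of $G$. For $\mathfrak{o}\in\mathcal{A}(G)$, a vertex $v$ is a sink if every edge incident with $v$ is directed toward $v$ (in particular, isolated vertices are sinks); $\operatorname{Sink}(\mathfrak{o})$ is the set of sinks of $\mathfrak{o}$. To each vertex $v\in V$ associate a commuting variable, also denoted $v$, and let $\mathbb{Z}[V]$ be the polynomial ring in these variables. The acyclic orientation polynomial of $G$ is $$A_G(V)=\sum_{\mathfrak{o}\in\mathcal{A}(G)}\ \prod_{v\in\operatorname{Sink}(\mathfrak{o})}v\ \in\mathbb{Z}[V].$$ A subset $S\subseteq E$ is identified with the spanning subgraph of $G$ with vertex set $V$ and edge set $S$, and $\mathcal{C}(S)$ is its set of connected components. For a connected component $C$ with vertex set $V(C)$, put $$v_C=1-\prod_{v\in V(C)}(1-v)\in\mathbb{Z}[V].$$ A broken circuit is (the edge set of) a cycle of $G$ with its smallest edge removed; here a loop is a cycle of length 1 (giving the empty broken circuit) and two parallel edges form a cycle of length 2. The broken circuit complex $\mathcal{B}_G$ is the collection of all spanning subgraphs $S\subseteq E$ which do not contain a broken circuit. *)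

theory Defs
  imports "HOL-Library.FuncSet" "HOL-Library.Uprod" "HOL-Library.Poly_Mapping"
begin

record ('v, 'e) multigraph =
  verts :: "'v set"
  edges :: "'e set"
  ends :: "'e \<Rightarrow> 'v uprod"  \<comment> \<open>a loop at \<open>v\<close> has ends \<open>Upair v v\<close>\<close>

definition finite_multigraph :: "('v, 'e) multigraph \<Rightarrow> bool" where
  "finite_multigraph G \<longleftrightarrow>
     finite (verts G) \<and> finite (edges G) \<and> (\<forall>e\<in>edges G. set_uprod (ends G e) \<subseteq> verts G)"

text \<open>An orientation sends each edge to the pair (tail, head). A loop gets only one
  orientation here instead of two; this is harmless because only acyclic ones are used.
  Taking extensional functions makes orientations that agree on the edges equal.\<close>

definition orientations :: "('v, 'e) multigraph \<Rightarrow> ('e \<Rightarrow> 'v \<times> 'v) set" where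
  "orientations G = (\<Pi>\<^sub>E e\<in>edges G. {(u, w). Upair u w = ends G e})"

definition directed_cycle ::
  "('v, 'e) multigraph \<Rightarrow> ('e \<Rightarrow> 'v \<times> 'v) \<Rightarrow> 'v list \<Rightarrow> 'e list \<Rightarrow> bool" where
  "directed_cycle G \<omega> vs es \<longleftrightarrow>
     es \<noteq> [] \<and> length vs = length es \<and> distinct vs \<and> distinct es \<and> set es \<subseteq> edges G \<and>
     (\<forall>i<length es. \<omega> (es ! i) = (vs ! i, vs ! (Suc i mod length es)))"

definition acyclic_orientations :: "('v, 'e) multigraph \<Rightarrow> ('e \<Rightarrow> 'v \<times> 'v) set" where
  "acyclic_orientations G = {\<omega> \<in> orientations G. \<nexists>vs es. directed_cycle G \<omega> vs es}"

definition sinks :: "('v, 'e) multigraph \<Rightarrow> ('e \<Rightarrow> 'v \<times> 'v) \<Rightarrow> 'v set" where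
  "sinks G \<omega> = {v \<in> verts G. \<forall>e\<in>edges G. v \<in> set_uprod (ends G e) \<longrightarrow> snd (\<omega> e) = v}"

text \<open>Integer polynomials in commuting variables indexed by \<open>'v\<close>, as finitely supported
  functions from monomials (exponent vectors) to coefficients. The ring \<open>\<int>[V]\<close> for
  \<open>V = verts G\<close> is the subring of those polynomials involving only variables from \<open>V\<close>.\<close>

type_synonym 'v int_mpoly = "('v \<Rightarrow>\<^sub>0 nat) \<Rightarrow>\<^sub>0 int"

definition Var :: "'v \<Rightarrow> 'v int_mpoly" where
  "Var v = Poly_Mapping.single (Poly_Mapping.single v 1) 1"

definition acyclic_orientation_poly :: "('v, 'e) multigraph \<Rightarrow> 'v int_mpoly" where
  "acyclic_orientation_poly G = (\<Sum>\<omega>\<in>acyclic_orientations G. \<Prod>v\<in>sinks G \<omega>. Var v)"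

definition connected_in :: "('v, 'e) multigraph \<Rightarrow> 'e set \<Rightarrow> 'v rel" where
  "connected_in G S =
     {(u, w) \<in> verts G \<times> verts G. (u, w) \<in> {(x, y). \<exists>e\<in>S. ends G e = Upair x y}\<^sup>*}"

text \<open>The connected components of the spanning subgraph with edge set \<open>S\<close>, each
  represented by its vertex set.\<close>

definition components :: "('v, 'e) multigraph \<Rightarrow> 'e set \<Rightarrow> 'v set set" where
  "components G S = verts G // connected_in G S"

definition component_poly :: "'v set \<Rightarrow> 'v int_mpoly" where
  "component_poly C = 1 - (\<Prod>v\<in>C. (1 - Var v))"

text \<open>Consecutive edges join consecutive vertices cyclically. Length 1 gives a loop; for
  length 2, distinctness of the edges forces two parallel edges.\<close>

definition cycle :: "('v, 'e) multigraph \<Rightarrow> 'v list \<Rightarrow> 'e list \<Rightarrow> bool" where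
  "cycle G vs es \<longleftrightarrow>
     es \<noteq> [] \<and> length vs = length es \<and> distinct vs \<and> distinct es \<and> set es \<subseteq> edges G \<and>
     (\<forall>i<length es. ends G (es ! i) = Upair (vs ! i) (vs ! (Suc i mod length es)))"

definition broken_circuit :: "('v, 'e) multigraph \<Rightarrow> 'e rel \<Rightarrow> 'e set \<Rightarrow> bool" where
  "broken_circuit G r B \<longleftrightarrow>
     (\<exists>vs es e. cycle G vs es \<and> e \<in> set es \<and> (\<forall>f\<in>set es. (e, f) \<in> r) \<and> B = set es - {e})"

definition broken_circuit_complex :: "('v, 'e) multigraph \<Rightarrow> 'e rel \<Rightarrow> 'e set set" where
  "broken_circuit_complex G r = {S. S \<subseteq> edges G \<and> (\<nexists>B. broken_circuit G r B \<and> B \<subseteq> S)}"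

end

theory Submission imports Defs begin

text \<open>For arbitrary vertex weights \<open>x\<close> in a commutative ring, both sides satisfy the same
  deletion-contraction recursion for the largest edge \<open>e = uv\<close>, where contracting \<open>e\<close>
  gives the merged vertex the weight \<open>x u + x v - x u * x v\<close>, so that
  \<open>1 - x\<close> is multiplicative.
  For orientations one compares the two extensions of an orientation \<open>R\<close> of \<open>G - e\<close>:
  if both are acyclic, then so is the orientation induced on \<open>G / e\<close>, and otherwise
  the only acyclic extension has the same sinks as \<open>R\<close>.
  For subgraphs one uses that \<open>S\<close> contains no broken circuit iff the ends of no edge
  \<open>f\<close> are connected by edges of \<open>S\<close> larger than \<open>f\<close>; this condition is
  compatible with deleting and contracting the largest edge.\<close>

section \<open>Merging two vertices\<close>

definition merge :: "'v \<Rightarrow> 'v \<Rightarrow> 'v \<Rightarrow> 'v" where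
  "merge u v p = (if p = v then u else p)"

definition merge_weight :: "'v \<Rightarrow> 'v \<Rightarrow> ('v \<Rightarrow> 'r::comm_ring_1) \<Rightarrow> 'v \<Rightarrow> 'r" where
  "merge_weight u v x = x(u := x u + x v - x u * x v)"

abbreviation merge_rel :: "'v \<Rightarrow> 'v \<Rightarrow> 'v rel \<Rightarrow> 'v rel" where
  "merge_rel u v R \<equiv> map_prod (merge u v) (merge u v) ` R"

definition conn :: "'v rel \<Rightarrow> 'v rel" where
  "conn Q = (Q \<union> Q\<inverse>)\<^sup>*"

text \<open>A set of arcs suffices, since parallel arcs affect neither acyclicity nor the set of
  tails. The value 0 lets sums run over all orientations.\<close>

definition orientation_weight :: "'v set \<Rightarrow> ('v \<Rightarrow> 'r::comm_ring_1) \<Rightarrow> 'v rel \<Rightarrow> 'r" where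
  "orientation_weight V x R = (if acyclic R then \<Prod>v\<in>V - Domain R. x v else 0)"

text \<open>\<open>Q\<close> lists each edge with an arbitrary order of its ends. The product runs
  over the set of classes, so each component gives one factor.\<close>

definition component_weight :: "'v set \<Rightarrow> ('v \<Rightarrow> 'r::comm_ring_1) \<Rightarrow> 'v rel \<Rightarrow> 'r" where
  "component_weight V x Q =
     (\<Prod>K\<in>(\<lambda>p. {q \<in> V. (p, q) \<in> conn Q}) ` V. 1 - (\<Prod>v\<in>K. 1 - x v))"

section \<open>Acyclicity after merging two vertices\<close>

lemma merge_image_trancl:
  "(p, q) \<in> R\<^sup>+ \<Longrightarrow> (merge u v p, merge u v q) \<in> (merge_rel u v R)\<^sup>+"
proof (induction rule: trancl_induct)
  case (base y)
  then show ?case by (force intro: r_into_trancl)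
next
  case (step y z)
  from step.hyps(2) have "(merge u v y, merge u v z) \<in> merge_rel u v R"
    by force
  with step.IH show ?case by (rule trancl_into_trancl)
qed

text \<open>A path of the quotient lifts to a path of \<open>R\<close> that may jump between
  \<open>u\<close> and \<open>v\<close>. Between two jumps it would run from \<open>{u, v}\<close>
  to \<open>{u, v}\<close>, which the hypotheses forbid, so at most one jump occurs.\<close>

lemma merge_trancl_lift:
  assumes "acyclic R" "(u, v) \<notin> R\<^sup>+" "(v, u) \<notin> R\<^sup>+"
    and "(p, q) \<in> (merge_rel u v R)\<^sup>+"
  shows "\<exists>p' q'. merge u v p' = p \<and> merge u v q' = q \<and>
    ((p', q') \<in> R\<^sup>+ \<or> (\<exists>c\<in>{u, v}. \<exists>d\<in>{u, v}. (p', c) \<in> R\<^sup>+ \<and> (d, q') \<in> R\<^sup>+))"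
  using assms(4)
proof (induction rule: trancl_induct)
  case (base y)
  then show ?case by force
next
  case (step y z)
  from step.hyps(2) obtain y'' z' where yz: "(y'', z') \<in> R" "merge u v y'' = y" "merge u v z' = z"
    by auto
  from step.IH obtain p' y' where py: "merge u v p' = p" "merge u v y' = y"
    "(p', y') \<in> R\<^sup>+ \<or> (\<exists>c\<in>{u, v}. \<exists>d\<in>{u, v}. (p', c) \<in> R\<^sup>+ \<and> (d, y') \<in> R\<^sup>+)"
    by blast
  show ?case
  proof (cases "y' = y''")
    case True
    then have "(p', z') \<in> R\<^sup>+ \<or> (\<exists>c\<in>{u, v}. \<exists>d\<in>{u, v}. (p', c) \<in> R\<^sup>+ \<and> (d, z') \<in> R\<^sup>+)"
      using py(3) yz(1) by (meson trancl_into_trancl)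
    then show ?thesis using py(1) yz(3) by blast
  next
    case False
    then have uv: "y' \<in> {u, v}" "y'' \<in> {u, v}"
      using py(2) yz(2) by (auto simp: merge_def split: if_splits)
    \<comment> \<open>Since \<open>y'\<close> lies in \<open>{u, v}\<close>, an earlier jump would
      leave a forbidden path from \<open>{u, v}\<close> to \<open>y'\<close>; the jump from
      \<open>y'\<close> to \<open>y''\<close> is thus the first.\<close>
    have "(p', y') \<in> R\<^sup>+"
      using py(3) assms(1-3) uv unfolding acyclic_def by auto
    then show ?thesis using py(1) yz uv by blast
  qed
qed

text \<open>A closed walk of the quotient yields either a closed walk of \<open>R\<close> or a path
  of \<open>R\<close> with both ends in \<open>{u, v}\<close>; conversely, a path between
  \<open>u\<close> and \<open>v\<close> closes up when they are merged.\<close>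

lemma acyclic_merge_iff:
  assumes "u \<noteq> v" "acyclic R"
  shows "acyclic (merge_rel u v R) \<longleftrightarrow> (u, v) \<notin> R\<^sup>+ \<and> (v, u) \<notin> R\<^sup>+"
proof
  assume "acyclic (merge_rel u v R)"
  then show "(u, v) \<notin> R\<^sup>+ \<and> (v, u) \<notin> R\<^sup>+"
    using merge_image_trancl[of u v R u v] merge_image_trancl[of v u R u v]
    by (auto simp: acyclic_def merge_def)
next
  assume uv: "(u, v) \<notin> R\<^sup>+ \<and> (v, u) \<notin> R\<^sup>+"
  show "acyclic (merge_rel u v R)"
    unfolding acyclic_def
  proof (intro allI notI)
    fix z assume "(z, z) \<in> (merge_rel u v R)\<^sup>+"
    with merge_trancl_lift[OF assms(2)] uv obtain p q where pq: "merge u v p = merge u v q"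
      "(p, q) \<in> R\<^sup>+ \<or> (\<exists>c\<in>{u, v}. \<exists>d\<in>{u, v}. (p, c) \<in> R\<^sup>+ \<and> (d, q) \<in> R\<^sup>+)"
      by metis
    have no: "(c, d) \<notin> R\<^sup>+" if "c \<in> {u, v}" "d \<in> {u, v}" for c d
      using that uv assms(2) by (auto simp: acyclic_def)
    show False
    proof (cases "p = q")
      case True
      then show False using pq(2) no assms(2) by (meson acyclic_def trancl_trans)
    next
      case False
      then have "p \<in> {u, v}" "q \<in> {u, v}"
        using pq(1) by (auto simp: merge_def split: if_splits)
      then show False using pq(2) no by blast
    qed
  qed
qed

lemma acyclic_if_acyclic_merge: "acyclic (merge_rel u v R) \<Longrightarrow> acyclic R"
  unfolding acyclic_def using merge_image_trancl by fast

lemma Domain_merge_rel: "Domain (merge_rel u v R) = merge u v ` Domain R"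
  by force

text \<open>Let \<open>a\<close> be \<open>x u\<close> if \<open>u\<close> is no tail in
  \<open>R\<close> and 1 otherwise, and \<open>b\<close> likewise for \<open>v\<close>. If no path
  joins \<open>u\<close> and \<open>v\<close>, the claim is
  \<open>b + a = a * b + (a + b - a * b)\<close> times the factor of the other sinks.\<close>

lemma orientation_weight_deletion_contraction:
  fixes x :: "'v \<Rightarrow> 'r::comm_ring_1"
  assumes V: "finite V" "u \<in> V" "v \<in> V" and uv: "u \<noteq> v"
  shows "orientation_weight V x (insert (u, v) R) + orientation_weight V x (insert (v, u) R) =
    orientation_weight V x R + orientation_weight (V - {v}) (merge_weight u v x) (merge_rel u v R)"
proof (cases "acyclic R")
  case False
  then show ?thesis
    using acyclic_if_acyclic_merge[of u v R] by (auto simp: orientation_weight_def acyclic_insert)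
next
  case True
  have rt: "(p, q) \<in> R\<^sup>* \<longleftrightarrow> (p, q) \<in> R\<^sup>+" if "p \<noteq> q" for p q
    using that by (auto simp: rtrancl_eq_or_trancl)
  have dom: "p \<in> Domain R" if "(p, q) \<in> R\<^sup>+" for p q
    using that by (metis Domain.DomainI trancl_domain)
  have not_both: "(u, v) \<notin> R\<^sup>+ \<or> (v, u) \<notin> R\<^sup>+"
    using True by (meson acyclic_def trancl_trans)
  have merge_iff: "acyclic (merge_rel u v R) \<longleftrightarrow> (u, v) \<notin> R\<^sup>+ \<and> (v, u) \<notin> R\<^sup>+"
    using acyclic_merge_iff[OF uv True] .
  show ?thesis
  proof (cases "(u, v) \<in> R\<^sup>+ \<or> (v, u) \<in> R\<^sup>+")
    case r: True
    then show ?thesis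
    proof
      assume "(u, v) \<in> R\<^sup>+"
      \<comment> \<open>The path from \<open>u\<close> to \<open>v\<close> already makes
        \<open>u\<close> a tail, so the arc \<open>(u, v)\<close> removes no sink, while the
        opposite arc closes a cycle.\<close>
      with dom have "insert u (Domain R) = Domain R" by blast
      with \<open>(u, v) \<in> R\<^sup>+\<close> show ?thesis
        using not_both True merge_iff rt uv
        by (simp add: orientation_weight_def acyclic_insert)
    next
      assume "(v, u) \<in> R\<^sup>+"
      with dom have "insert v (Domain R) = Domain R" by blast
      with \<open>(v, u) \<in> R\<^sup>+\<close> show ?thesis
        using not_both True merge_iff rt uv
        by (simp add: orientation_weight_def acyclic_insert)
    qed
  next
    case False
    \<comment> \<open>The sinks other than \<open>u\<close> and \<open>v\<close>, which are common
      to all four relations of the identity.\<close>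
    define W where "W = V - {u, v} - Domain R"
    define P where "P = (\<Prod>p\<in>W. x p)"
    have W: "finite W" "u \<notin> W" "v \<notin> W" using V by (auto simp: W_def)
    have D: "(\<Prod>p\<in>V - D. x p) = (if u \<in> D then 1 else x u) * (if v \<in> D then 1 else x v) * P"
      if "D - {u, v} = Domain R - {u, v}" for D
    proof -
      have "V - D = (if u \<in> D then {} else {u}) \<union> (if v \<in> D then {} else {v}) \<union> W"
        using that V by (auto simp: W_def)
      then show ?thesis using W uv by (auto simp: P_def)
    qed
    have P': "(\<Prod>p\<in>W. merge_weight u v x p) = P"
      unfolding P_def using W by (intro prod.cong) (auto simp: merge_weight_def)
    have "(V - {v}) - Domain (merge_rel u v R) =
        (if u \<in> Domain R \<or> v \<in> Domain R then {} else {u}) \<union> W"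
      unfolding Domain_merge_rel using V uv by (auto simp: W_def merge_def image_iff)
    then have M: "(\<Prod>p\<in>(V - {v}) - Domain (merge_rel u v R). merge_weight u v x p) =
        (if u \<in> Domain R \<or> v \<in> Domain R then 1 else x u + x v - x u * x v) * P"
      using W P' by (auto simp: merge_weight_def)
    have ac: "acyclic (insert (u, v) R)" "acyclic (insert (v, u) R)" "acyclic (merge_rel u v R)"
      using False True merge_iff rt uv by (auto simp: acyclic_insert)
    show ?thesis
      unfolding orientation_weight_def
      by (subst (1 2 3) D, (auto)[3], subst M) (use ac True uv in \<open>auto simp: algebra_simps\<close>)
  qed
qed

section \<open>Connected components after merging two vertices\<close>

lemma conn_refl [simp]: "(p, p) \<in> conn Q"
  by (simp add: conn_def)

lemma conn_sym: "(p, q) \<in> conn Q \<Longrightarrow> (q, p) \<in> conn Q"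
  unfolding conn_def by (metis sym_Un_converse sym_rtrancl symE)

lemma conn_trans: "(p, q) \<in> conn Q \<Longrightarrow> (q, s) \<in> conn Q \<Longrightarrow> (p, s) \<in> conn Q"
  unfolding conn_def by (rule rtrancl_trans)

lemma conn_base: "(p, q) \<in> Q \<Longrightarrow> (p, q) \<in> conn Q"
  unfolding conn_def by blast

lemma conn_induct [consumes 1, case_names refl step]:
  assumes "(p, q) \<in> conn Q" "P p"
    and "\<And>y z. (p, y) \<in> conn Q \<Longrightarrow> (y, z) \<in> Q \<or> (z, y) \<in> Q \<Longrightarrow> P y \<Longrightarrow> P z"
  shows "P q"
  using assms(1) unfolding conn_def
  by (induction rule: rtrancl_induct) (use assms in \<open>auto simp: conn_def\<close>)

lemma conn_empty [simp]: "conn {} = Id"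
  by (simp add: conn_def)

lemma conn_merge_self: "(merge u v p, p) \<in> conn (insert (u, v) Q)"
  by (auto simp: merge_def intro: conn_base)

text \<open>In one direction the edge \<open>(u, v)\<close> collapses to a point; in the other it
  connects each vertex with its image.\<close>

lemma conn_merge_iff:
  "(merge u v p, merge u v q) \<in> conn (merge_rel u v Q) \<longleftrightarrow> (p, q) \<in> conn (insert (u, v) Q)"
proof
  let ?Q = "insert (u, v) Q"
  assume "(p, q) \<in> conn ?Q"
  then show "(merge u v p, merge u v q) \<in> conn (merge_rel u v Q)"
  proof (induction rule: conn_induct)
    case (step y z)
    have "(merge u v y, merge u v z) \<in> conn (merge_rel u v Q)"
    proof (cases "{y, z} = {u, v}")
      case True
      then have "merge u v y = merge u v z" by (auto simp: merge_def doubleton_eq_iff)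
      then show ?thesis by simp
    next
      case False
      with step.hyps have "(y, z) \<in> Q \<or> (z, y) \<in> Q" by auto
      then show ?thesis by (force intro: conn_base conn_sym)
    qed
    with step.IH show ?case by (rule conn_trans)
  qed simp
next
  let ?Q = "insert (u, v) Q"
  assume "(merge u v p, merge u v q) \<in> conn (merge_rel u v Q)"
  then have "(merge u v p, merge u v q) \<in> conn ?Q"
  proof (induction rule: conn_induct)
    case (step y z)
    have *: "(merge u v s, merge u v t) \<in> conn ?Q" if "(s, t) \<in> Q" for s t
    proof -
      have "(s, t) \<in> conn ?Q" using that by (intro conn_base) auto
      then show ?thesis using conn_merge_self[of u v _ Q] conn_sym conn_trans by metis
    qed
    have "(y, z) \<in> conn ?Q"
      using step.hyps * by (auto intro: conn_sym)
    with step.IH show ?case by (rule conn_trans)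
  qed simp
  then show "(p, q) \<in> conn ?Q"
    using conn_merge_self[of u v _ Q] conn_sym conn_trans by metis
qed

text \<open>Removing \<open>v\<close> from the components matches the two families, and
  \<open>1 - (x u + x v - x u * x v) = (1 - x u) * (1 - x v)\<close> makes the factors
  agree.\<close>

lemma component_weight_merge:
  fixes x :: "'v \<Rightarrow> 'r::comm_ring_1"
  assumes V: "finite V" "u \<in> V" "v \<in> V" and uv: "u \<noteq> v"
  shows "component_weight (V - {v}) (merge_weight u v x) (merge_rel u v Q) =
    component_weight V x (insert (u, v) Q)"
proof -
  let ?K = "\<lambda>p. {q \<in> V. (p, q) \<in> conn (insert (u, v) Q)}"
  let ?K' = "\<lambda>p. {q \<in> V - {v}. (p, q) \<in> conn (merge_rel u v Q)}"
  have K': "?K' (merge u v p) = ?K p - {v}" if "p \<in> V" for p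
  proof -
    have "(merge u v p, q) \<in> conn (merge_rel u v Q) \<longleftrightarrow> (p, q) \<in> conn (insert (u, v) Q)"
      if "q \<noteq> v" for q
      using conn_merge_iff[of u v p q Q] that by (simp add: merge_def)
    then show ?thesis by auto
  qed
  have "merge u v ` V = V - {v}"
    using V uv by (auto simp: merge_def image_iff)
  then have "?K' ` (V - {v}) = ?K' ` merge u v ` V" by simp
  also have "\<dots> = (\<lambda>K. K - {v}) ` ?K ` V"
    unfolding image_image using K' by (intro image_cong) auto
  finally have im: "?K' ` (V - {v}) = (\<lambda>K. K - {v}) ` ?K ` V" .
  have uvK: "u \<in> K \<longleftrightarrow> v \<in> K" if "K \<in> ?K ` V" for K
  proof -
    have "(u, v) \<in> conn (insert (u, v) Q)" by (intro conn_base) auto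
    then have "(p, u) \<in> conn (insert (u, v) Q) \<longleftrightarrow> (p, v) \<in> conn (insert (u, v) Q)" for p
      by (meson conn_trans conn_sym)
    then show ?thesis using that V by auto
  qed
  \<comment> \<open>A component contains \<open>v\<close> iff it contains \<open>u\<close>, and
    \<open>u\<close> is kept, so \<open>K - {v}\<close> determines \<open>K\<close>.\<close>
  have inj: "inj_on (\<lambda>K. K - {v}) (?K ` V)"
  proof (rule inj_onI)
    fix K L assume *: "K \<in> ?K ` V" "L \<in> ?K ` V" "K - {v} = L - {v}"
    then have "u \<in> K \<longleftrightarrow> u \<in> L" using uv by blast
    then have "v \<in> K \<longleftrightarrow> v \<in> L" using uvK * by blast
    with *(3) show "K = L" by blast
  qed
  have factor: "(\<Prod>p\<in>K - {v}. 1 - merge_weight u v x p) = (\<Prod>p\<in>K. 1 - x p)"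
    if K: "K \<in> ?K ` V" for K
  proof (cases "v \<in> K")
    case False
    with uvK[OF K] have "u \<notin> K" by simp
    with False show ?thesis by (intro prod.cong) (auto simp: merge_weight_def)
  next
    case True
    define L where "L = K - {u, v}"
    have "K \<subseteq> V" using K by auto
    then have L: "finite L" "u \<notin> L" "v \<notin> L"
      using V(1) by (auto simp: L_def intro: finite_subset)
    have KL: "K - {v} = insert u L" "K = insert u (insert v L)"
      using True uvK[OF K] uv by (auto simp: L_def)
    have "(\<Prod>p\<in>L. 1 - merge_weight u v x p) = (\<Prod>p\<in>L. 1 - x p)"
      using L by (intro prod.cong) (auto simp: merge_weight_def)
    then show ?thesis
      unfolding KL(1) using L uv by (subst KL(2)) (simp add: merge_weight_def algebra_simps)
  qed
  show ?thesis
    unfolding component_weight_def im prod.reindex[OF inj] comp_def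
    using factor by (intro prod.cong) auto
qed

section \<open>Deletion and contraction for weighted sums\<close>

lemma sum_Pow_insert:
  assumes "finite A" "a \<notin> A"
  shows "(\<Sum>F\<in>Pow (insert a A). g F) = (\<Sum>F\<in>Pow A. g F) + (\<Sum>F\<in>Pow A. g (insert a F))"
proof -
  have "inj_on (insert a) (Pow A)" using assms(2) by (auto intro!: inj_onI)
  then show ?thesis
    unfolding Pow_insert using assms by (subst sum.union_disjoint) (auto simp: sum.reindex)
qed

text \<open>An orientation is encoded by the set \<open>F\<close> of edges on which it differs from the
  reference orientation \<open>d\<close>.\<close>

definition flip :: "('e \<Rightarrow> 'v \<times> 'v) \<Rightarrow> 'e set \<Rightarrow> 'e \<Rightarrow> 'v \<times> 'v" where
  "flip d F e = (if e \<in> F then prod.swap (d e) else d e)"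

text \<open>No broken circuit lies in \<open>S\<close>: one with missing edge \<open>f\<close> is a path between the
  ends of \<open>f\<close> consisting of edges larger than \<open>f\<close>.\<close>

definition nbc :: "('e \<Rightarrow> 'e \<Rightarrow> bool) \<Rightarrow> ('e \<Rightarrow> 'v \<times> 'v) \<Rightarrow> 'e set \<Rightarrow> 'e set \<Rightarrow> bool" where
  "nbc lt d E S \<longleftrightarrow> (\<forall>f\<in>E. d f \<notin> conn (d ` {g \<in> S. lt f g}))"

text \<open>Only the condition for \<open>e\<close> is new. As no edge of \<open>S\<close> exceeds
  \<open>e\<close>, it merely asks that \<open>e\<close> be no loop.\<close>

lemma nbc_delete_max:
  assumes "fst (d e) \<noteq> snd (d e)" "\<And>f. f \<in> insert e S \<Longrightarrow> \<not> lt e f"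
  shows "nbc lt d (insert e E) S \<longleftrightarrow> nbc lt d E S"
proof -
  have empty: "{g \<in> S. lt e g} = {}" using assms(2) by auto
  have "d e \<notin> conn (d ` {g \<in> S. lt e g})"
    unfolding empty using assms(1) by (cases "d e") auto
  then show ?thesis by (simp add: nbc_def)
qed

text \<open>For each \<open>f\<close> in \<open>E\<close>, the edge \<open>e\<close> is among the
  edges larger than \<open>f\<close>, and joining the ends of \<open>e\<close> affects connectivity
  as merging them does.\<close>

lemma nbc_contract_max:
  assumes e: "d e = (u, v)" "u \<noteq> v"
    and max: "\<And>f. f \<in> insert e S \<Longrightarrow> \<not> lt e f" "\<And>f. f \<in> E \<Longrightarrow> lt f e"
  shows "nbc lt d (insert e E) (insert e S) \<longleftrightarrow>
    nbc lt (map_prod (merge u v) (merge u v) \<circ> d) E S"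
proof -
  have *: "d f \<notin> conn (d ` {g \<in> insert e S. lt f g}) \<longleftrightarrow>
     (map_prod (merge u v) (merge u v) \<circ> d) f \<notin>
       conn ((map_prod (merge u v) (merge u v) \<circ> d) ` {g \<in> S. lt f g})" if "f \<in> E" for f
  proof -
    have "{g \<in> insert e S. lt f g} = insert e {g \<in> S. lt f g}"
      using max(2)[OF that] by auto
    then have "d ` {g \<in> insert e S. lt f g} = insert (u, v) (d ` {g \<in> S. lt f g})"
      using e by simp
    then show ?thesis
      using conn_merge_iff[of u v "fst (d f)" "snd (d f)" "d ` {g \<in> S. lt f g}"]
      by (simp add: image_comp map_prod_def case_prod_unfold)
  qed
  have empty: "{g \<in> insert e S. lt e g} = {}" using max(1) by auto
  have "d e \<notin> conn (d ` {g \<in> insert e S. lt e g})"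
    unfolding empty using e by simp
  then show ?thesis using * unfolding nbc_def by blast
qed

text \<open>Induction on \<open>E\<close> with \<open>V\<close>, \<open>d\<close> and
  \<open>x\<close> arbitrary, because contraction changes all three.\<close>

lemma orientation_sum_eq_nbc_sum:
  fixes x :: "'v \<Rightarrow> 'r::comm_ring_1"
  assumes "finite V" "finite E" "d ` E \<subseteq> V \<times> V"
    and "asymp_on E lt" "transp_on E lt" "totalp_on E lt"
  shows "(\<Sum>F\<in>Pow E. orientation_weight V x (flip d F ` E)) =
    (\<Sum>S\<in>Pow E. if nbc lt d E S then component_weight V x (d ` S) else 0)"
  using assms(2,1,3-)
proof (induction E arbitrary: V d x rule: finite_psubset_induct)
  case (psubset E)
  show ?case
  proof (cases "E = {}")
    case True
    \<comment> \<open>Without edges every vertex is a sink and forms its own component, with factor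
      \<open>1 - (1 - x p) = x p\<close>.\<close>
    have "component_weight V x {} = (\<Prod>p\<in>V. x p)"
    proof -
      have "(\<lambda>p. {q \<in> V. (p, q) \<in> conn {}}) ` V = (\<lambda>p. {p}) ` V"
        by (intro image_cong) auto
      then show ?thesis
        unfolding component_weight_def by (simp add: prod.reindex)
    qed
    then show ?thesis
      using True by (simp add: orientation_weight_def nbc_def acyclic_def)
  next
    case False
    obtain e where e: "e \<in> E" "\<And>f. f \<in> E \<Longrightarrow> f \<noteq> e \<Longrightarrow> \<not> lt e f"
      using Finite_Set.bex_max_element[of E lt] False psubset.hyps psubset.prems by metis
    define E' where "E' = E - {e}"
    have E: "E = insert e E'" "e \<notin> E'" "finite E'" "E' \<subset> E"
      using e psubset.hyps by (auto simp: E'_def)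
    have gt: "lt f e" if "f \<in> E'" for f
      using that e E psubset.prems(5) by (metis insertCI totalp_onD psubsetD)
    have not_lt: "\<not> lt e f" if "f \<in> insert e E'" for f
      using that e E psubset.prems(3) by (metis asymp_onD)
    obtain u v where uv: "d e = (u, v)" by fastforce
    have uvV: "u \<in> V" "v \<in> V" using uv e(1) psubset.prems(2) by auto
    show ?thesis
    proof (cases "u = v")
      case True
      \<comment> \<open>A loop is a directed cycle in every orientation, and the empty path connects
        its ends, so both sums vanish.\<close>
      have "(u, u) \<in> flip d F ` E" for F
        using e(1) uv True by (auto simp: flip_def image_iff intro!: bexI[of _ e])
      then have "\<not> acyclic (flip d F ` E)" for F
        unfolding acyclic_def by blast
      moreover have "\<not> nbc lt d E S" for S
        using e(1) uv True unfolding nbc_def by (metis conn_refl)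
      ultimately show ?thesis by (simp add: orientation_weight_def)
    next
      case False
      let ?d' = "map_prod (merge u v) (merge u v) \<circ> d"
      let ?W = "orientation_weight V x" and ?W' = "orientation_weight (V - {v}) (merge_weight u v x)"
      let ?C = "component_weight V x" and ?C' = "component_weight (V - {v}) (merge_weight u v x)"
      have sub: "asymp_on E' lt" "transp_on E' lt" "totalp_on E' lt"
        using psubset.prems(3-5) E(4)
        by (meson asymp_on_subset transp_on_subset totalp_on_subset psubset_imp_subset)+
      have dV: "d ` E' \<subseteq> V \<times> V" using psubset.prems(2) E(4) by blast
      have d'V: "?d' ` E' \<subseteq> (V - {v}) \<times> (V - {v})"
      proof -
        have "merge u v p \<in> V - {v}" if "p \<in> V" for p
          using that uvV False by (auto simp: merge_def)
        then show ?thesis using dV by (auto simp: image_subset_iff mem_Times_iff)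
      qed
      \<comment> \<open>Subsets of \<open>E\<close> are paired by whether \<open>e\<close> is
        flipped, giving its two possible arcs.\<close>
      have "flip d F ` E = insert (u, v) (flip d F ` E')"
        "flip d (insert e F) ` E = insert (v, u) (flip d F ` E')"
        if "F \<in> Pow E'" for F
      proof -
        have "flip d F e = (u, v)" "flip d (insert e F) e = (v, u)"
          using that E(2) uv by (auto simp: flip_def)
        moreover have "flip d (insert e F) ` E' = flip d F ` E'"
          using E(2) by (intro image_cong) (auto simp: flip_def)
        ultimately show "flip d F ` E = insert (u, v) (flip d F ` E')"
          "flip d (insert e F) ` E = insert (v, u) (flip d F ` E')"
          by (simp_all only: E(1) image_insert)
      qed
      then have "(\<Sum>F\<in>Pow E. ?W (flip d F ` E)) = (\<Sum>F\<in>Pow E'.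
          ?W (insert (u, v) (flip d F ` E')) + ?W (insert (v, u) (flip d F ` E')))"
        unfolding sum.distrib
          sum_Pow_insert[OF E(3,2), of "\<lambda>F. ?W (flip d F ` E)", folded E(1)]
        by (intro arg_cong2[where f = "(+)"] sum.cong) simp_all
      also have "\<dots> = (\<Sum>F\<in>Pow E'. ?W (flip d F ` E')) + (\<Sum>F\<in>Pow E'. ?W' (flip ?d' F ` E'))"
      proof -
        \<comment> \<open>Merging commutes with reversing arcs, so the set of flipped edges stays
          the same under contraction.\<close>
        have "merge_rel u v (flip d F ` E') = flip ?d' F ` E'" for F
          unfolding image_image by (intro image_cong) (auto simp: flip_def prod.swap_def)
        then show ?thesis
          unfolding orientation_weight_deletion_contraction[OF psubset.prems(1) uvV False]
          by (simp add: sum.distrib)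
      qed
      also have "(\<Sum>F\<in>Pow E'. ?W (flip d F ` E')) =
          (\<Sum>S\<in>Pow E'. if nbc lt d E' S then ?C (d ` S) else 0)"
        using psubset.prems(1) dV sub by (intro psubset.IH[OF E(4)])
      also have "(\<Sum>F\<in>Pow E'. ?W' (flip ?d' F ` E')) =
          (\<Sum>S\<in>Pow E'. if nbc lt ?d' E' S then ?C' (?d' ` S) else 0)"
        using psubset.prems(1) d'V sub by (intro psubset.IH[OF E(4)]) auto
      also have "(\<Sum>S\<in>Pow E'. if nbc lt d E' S then ?C (d ` S) else 0) =
          (\<Sum>S\<in>Pow E'. if nbc lt d E S then ?C (d ` S) else 0)"
      proof (rule sum.cong)
        fix S assume "S \<in> Pow E'"
        then have "nbc lt d E S \<longleftrightarrow> nbc lt d E' S"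
          unfolding E(1) using uv False not_lt by (intro nbc_delete_max) auto
        then show "(if nbc lt d E' S then ?C (d ` S) else 0) =
          (if nbc lt d E S then ?C (d ` S) else 0)" by simp
      qed simp
      \<comment> \<open>Contraction accounts for the subsets containing \<open>e\<close>, deletion
        for those avoiding it.\<close>
      also have "(\<Sum>S\<in>Pow E'. if nbc lt ?d' E' S then ?C' (?d' ` S) else 0) =
          (\<Sum>S\<in>Pow E'. if nbc lt d E (insert e S) then ?C (d ` insert e S) else 0)"
      proof (rule sum.cong)
        fix S assume S: "S \<in> Pow E'"
        have "nbc lt d E (insert e S) \<longleftrightarrow> nbc lt ?d' E' S"
          unfolding E(1) using uv False not_lt gt S by (intro nbc_contract_max) auto
        moreover have "?C' (?d' ` S) = ?C (d ` insert e S)"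
          using component_weight_merge[OF psubset.prems(1) uvV False, of x "d ` S"] uv
          by (simp add: image_comp)
        ultimately show "(if nbc lt ?d' E' S then ?C' (?d' ` S) else 0) =
          (if nbc lt d E (insert e S) then ?C (d ` insert e S) else 0)" by simp
      qed simp
      finally show ?thesis
        unfolding E(1) sum_Pow_insert[OF E(3,2)] .
    qed
  qed
qed

section \<open>Cycles and reachability\<close>

lemma rtrancl_imp_simple_path:
  assumes "(p, q) \<in> R\<^sup>*"
  shows "\<exists>vs. vs \<noteq> [] \<and> distinct vs \<and> hd vs = p \<and> last vs = q \<and>
    (\<forall>i. Suc i < length vs \<longrightarrow> (vs ! i, vs ! Suc i) \<in> R)"
  using assms
proof (induction rule: rtrancl_induct)
  case base
  show ?case by (intro exI[of _ "[p]"]) simp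
next
  case (step y z)
  then obtain vs where vs: "vs \<noteq> []" "distinct vs" "hd vs = p" "last vs = y"
    "\<And>i. Suc i < length vs \<Longrightarrow> (vs ! i, vs ! Suc i) \<in> R"
    by blast
  show ?case
  proof (cases "z \<in> set vs")
    case True
    \<comment> \<open>If \<open>z\<close> was already visited, the path is cut at that
      visit.\<close>
    then obtain i where i: "i < length vs" "vs ! i = z" by (auto simp: in_set_conv_nth)
    then have "last (take (Suc i) vs) = z" by (simp add: take_Suc_conv_app_nth)
    then show ?thesis
      using vs i by (intro exI[of _ "take (Suc i) vs"]) auto
  next
    case False
    have edge: "((vs @ [z]) ! i, (vs @ [z]) ! Suc i) \<in> R" if "Suc i < length (vs @ [z])" for i
    proof (cases "Suc i < length vs")
      case True
      then show ?thesis using vs(5) by (simp add: nth_append)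
    next
      case False
      then have "i = length vs - 1" "Suc i = length vs" using that by auto
      then show ?thesis using vs(1,4) step.hyps(2) by (simp add: nth_append last_conv_nth)
    qed
    show ?thesis
      using vs False by (intro exI[of _ "vs @ [z]"] conjI allI impI edge) simp_all
  qed
qed

text \<open>Taking \<open>K\<close> to be \<^const>\<open>Pair\<close> or \<^const>\<open>Upair\<close> covers directed and undirected cycles.\<close>

lemma simple_cycle_through_edge:
  assumes K: "\<And>x y x' y'. K x y = K x' y' \<Longrightarrow> {x, y} = {x', y'}"
    and path: "(q, p) \<in> {(x, y). \<exists>e\<in>T. h e = K x y}\<^sup>*"
    and f: "h f = K p q" "f \<notin> T"
  shows "\<exists>vs es. es \<noteq> [] \<and> length vs = length es \<and> distinct vs \<and> distinct es \<and>
    f \<in> set es \<and> set es \<subseteq> insert f T \<and>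
    (\<forall>i<length es. h (es ! i) = K (vs ! i) (vs ! (Suc i mod length es)))"
proof -
  obtain vs where vs: "vs \<noteq> []" "distinct vs" "hd vs = q" "last vs = p"
    "\<And>i. Suc i < length vs \<Longrightarrow> \<exists>e\<in>T. h e = K (vs ! i) (vs ! Suc i)"
    using rtrancl_imp_simple_path[OF path] by blast
  \<comment> \<open>The number of path edges. The closing edge \<open>f\<close> gets index
    \<open>m\<close>, and \<open>Suc m mod Suc m = 0\<close> leads back to \<open>q\<close>. For
    \<open>p = q\<close> this is 0 and the cycle is a loop.\<close>
  define m where "m = length vs - 1"
  have m: "length vs = Suc m" using vs(1) by (simp add: m_def)
  obtain g where g: "\<And>i. i < m \<Longrightarrow> g i \<in> T \<and> h (g i) = K (vs ! i) (vs ! Suc i)"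
    using vs(5) m by (metis Suc_less_eq)
  \<comment> \<open>Equal edges have equal sets of ends, but the consecutive pairs on a simple path
    are pairwise different even as unordered pairs.\<close>
  have inj: "inj_on g {0..<m}"
  proof (rule inj_onI)
    fix i j assume ij: "i \<in> {0..<m}" "j \<in> {0..<m}" "g i = g j"
    then have "{vs ! i, vs ! Suc i} = {vs ! j, vs ! Suc j}"
      using g by (metis K atLeastLessThan_iff)
    then show "i = j"
      using ij(1,2) vs(2) m by (auto simp: doubleton_eq_iff nth_eq_iff_index_eq)
  qed
  define es where "es = map g [0..<m] @ [f]"
  have "h (es ! i) = K (vs ! i) (vs ! (Suc i mod length es))" if "i < length es" for i
  proof (cases "i < m")
    case True
    then show ?thesis using g by (simp add: es_def nth_append)
  next
    case False
    then have "i = m" using that by (simp add: es_def)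
    then show ?thesis
      using f vs m by (simp add: es_def nth_append hd_conv_nth last_conv_nth)
  qed
  moreover have "distinct es"
    using inj g f(2) by (auto simp: es_def distinct_map)
  moreover have "set es \<subseteq> insert f T" "f \<in> set es"
    using g by (auto simp: es_def)
  ultimately show ?thesis
    using vs(2) m by (intro exI[of _ vs] exI[of _ es]) (auto simp: es_def)
qed

text \<open>Walking around the cycle from the vertex after edge \<open>k\<close> back to the vertex
  before it uses only the other edges, as the edges are distinct.\<close>

lemma cycle_minus_edge_path:
  assumes len: "length vs = length es" and dist: "distinct es" and k: "k < length es"
    and step: "\<And>i. i < length es \<Longrightarrow> h (es ! i) = K (vs ! i) (vs ! (Suc i mod length es))"
  shows "(vs ! (Suc k mod length es), vs ! k) \<in> {(x, y). \<exists>e\<in>set es - {es ! k}. h e = K x y}\<^sup>*"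
proof -
  let ?n = "length es"
  let ?R = "{(x, y). \<exists>e\<in>set es - {es ! k}. h e = K x y}"
  have "j < ?n \<Longrightarrow> (vs ! (Suc k mod ?n), vs ! ((Suc k + j) mod ?n)) \<in> ?R\<^sup>*" for j
  proof (induction j)
    case (Suc j)
    let ?i = "(Suc k + j) mod ?n"
    have i: "?i < ?n" using k by (intro mod_less_divisor) auto
    \<comment> \<open>The index returns to \<open>k\<close> only at \<open>j = ?n - 1\<close>, which
      \<open>Suc j < ?n\<close> excludes.\<close>
    have "?i \<noteq> k"
      using Suc.prems k by (auto simp: mod_if)
    then have "es ! ?i \<in> set es - {es ! k}"
      using i k dist by (simp add: nth_eq_iff_index_eq)
    moreover have "h (es ! ?i) = K (vs ! ?i) (vs ! ((Suc k + Suc j) mod ?n))"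
      using step[OF i] by (simp add: mod_Suc_eq)
    ultimately have "(vs ! ?i, vs ! ((Suc k + Suc j) mod ?n)) \<in> ?R" by blast
    with Suc show ?case by (meson Suc_lessD rtrancl.rtrancl_into_rtrancl)
  qed simp
  from this[of "?n - 1"] have "(vs ! (Suc k mod ?n), vs ! ((Suc k + (?n - 1)) mod ?n)) \<in> ?R\<^sup>*"
    using k by linarith
  moreover have "Suc k + (?n - 1) = k + ?n" using k by simp
  moreover have "(k + ?n) mod ?n = k" using k by simp
  ultimately show ?thesis by (simp only:)
qed

text \<open>This permits replacing an orientation by its set of arcs: a closed walk of arcs can be
  shortened to a cycle with distinct vertices and edges.\<close>

lemma directed_cycle_iff_not_acyclic:
  "(\<exists>vs es. directed_cycle G \<omega> vs es) \<longleftrightarrow> \<not> acyclic (\<omega> ` edges G)"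
proof
  assume "\<exists>vs es. directed_cycle G \<omega> vs es"
  then obtain vs es where c: "es \<noteq> []" "length vs = length es" "distinct es" "set es \<subseteq> edges G"
    "\<And>i. i < length es \<Longrightarrow> \<omega> (es ! i) = (vs ! i, vs ! (Suc i mod length es))"
    by (auto simp: directed_cycle_def)
  have "{(x, y). \<exists>e\<in>set es - {es ! 0}. \<omega> e = (x, y)} \<subseteq> \<omega> ` edges G"
    using c(4) by force
  with cycle_minus_edge_path[of vs es 0 \<omega> Pair] c
  have "(vs ! (Suc 0 mod length es), vs ! 0) \<in> (\<omega> ` edges G)\<^sup>*"
    by (meson in_mono length_greater_0_conv rtrancl_mono)
  moreover have "(vs ! 0, vs ! (Suc 0 mod length es)) \<in> \<omega> ` edges G"
    using c by (metis image_eqI length_greater_0_conv nth_mem subsetD)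
  ultimately show "\<not> acyclic (\<omega> ` edges G)"
    unfolding acyclic_def by (meson rtrancl_into_trancl2)
next
  assume "\<not> acyclic (\<omega> ` edges G)"
  then obtain p q where pq: "(p, q) \<in> \<omega> ` edges G" "(q, p) \<in> (\<omega> ` edges G)\<^sup>*"
    unfolding acyclic_def by (meson tranclD)
  then obtain f where f: "f \<in> edges G" "\<omega> f = (p, q)" by auto
  \<comment> \<open>The return path must avoid \<open>f\<close>, which leaves \<open>p\<close>. A
    walk to \<open>p\<close> can stop at its first visit there, so it needs no edge leaving
    \<open>p\<close>.\<close>
  let ?T = "{e \<in> edges G. fst (\<omega> e) \<noteq> p}"
  have "(q, p) \<in> {(x, y). \<exists>e\<in>?T. \<omega> e = (x, y)}\<^sup>*"
    using pq(2)
  proof (induction rule: converse_rtrancl_induct)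
    case (step y z)
    show ?case
    proof (cases "y = p")
      case False
      from step.hyps(1) obtain e where "e \<in> edges G" "\<omega> e = (y, z)" by auto
      with False have "(y, z) \<in> {(x, y). \<exists>e\<in>?T. \<omega> e = (x, y)}" by force
      then show ?thesis using step.IH by (rule converse_rtrancl_into_rtrancl)
    qed simp
  qed simp
  then have "\<exists>vs es. es \<noteq> [] \<and> length vs = length es \<and> distinct vs \<and> distinct es \<and>
    f \<in> set es \<and> set es \<subseteq> insert f ?T \<and>
    (\<forall>i<length es. \<omega> (es ! i) = (vs ! i, vs ! (Suc i mod length es)))"
    using f by (intro simple_cycle_through_edge) auto
  then show "\<exists>vs es. directed_cycle G \<omega> vs es"
    unfolding directed_cycle_def using f(1) by blast
qed

section \<open>The acyclic orientation polynomial\<close>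

lemma conn_image_eq:
  assumes "\<And>e. Upair (fst (d e)) (snd (d e)) = ends G e"
  shows "conn (d ` T) = {(x, y). \<exists>e\<in>T. ends G e = Upair x y}\<^sup>*"
proof -
  have "d e = (x, y) \<or> d e = (y, x) \<longleftrightarrow> ends G e = Upair x y" for e x y
    using assms[of e, symmetric] by (cases "d e") auto
  then have "d ` T \<union> (d ` T)\<inverse> = {(x, y). \<exists>e\<in>T. ends G e = Upair x y}"
    by (auto simp: image_iff) metis+
  then show ?thesis by (simp add: conn_def)
qed

text \<open>Removing the least edge \<open>f\<close> of a cycle leaves a path of larger edges
  between its ends; conversely, such a path, made simple, closes up with \<open>f\<close> to a cycle
  whose least edge is \<open>f\<close>.\<close>

lemma broken_circuit_complex_eq_nbc:
  assumes d: "\<And>e. Upair (fst (d e)) (snd (d e)) = ends G e"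
    and r: "refl_on (edges G) r"
  shows "broken_circuit_complex G r =
    {S \<in> Pow (edges G). nbc (\<lambda>f g. (f, g) \<in> r \<and> f \<noteq> g) d (edges G) S}"
proof -
  let ?T = "\<lambda>S f. {g \<in> S. (f, g) \<in> r \<and> f \<noteq> g}"
  have "(\<exists>B. broken_circuit G r B \<and> B \<subseteq> S) \<longleftrightarrow> (\<exists>f\<in>edges G. d f \<in> conn (d ` ?T S f))"
    if S: "S \<subseteq> edges G" for S
  proof
    assume "\<exists>B. broken_circuit G r B \<and> B \<subseteq> S"
    then obtain vs es e where c: "cycle G vs es" "e \<in> set es"
      "\<And>f. f \<in> set es \<Longrightarrow> (e, f) \<in> r" "set es - {e} \<subseteq> S"
      unfolding broken_circuit_def by blast
    then obtain k where k: "k < length es" "es ! k = e" by (auto simp: in_set_conv_nth)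
    have "(vs ! (Suc k mod length es), vs ! k) \<in>
        {(x, y). \<exists>g\<in>set es - {es ! k}. ends G g = Upair x y}\<^sup>*"
      using c(1) k unfolding cycle_def by (intro cycle_minus_edge_path) auto
    moreover have "{(x, y). \<exists>g\<in>set es - {es ! k}. ends G g = Upair x y} \<subseteq>
        {(x, y). \<exists>g\<in>?T S e. ends G g = Upair x y}"
      using c k by blast
    ultimately have *: "(vs ! (Suc k mod length es), vs ! k) \<in> conn (d ` ?T S e)"
      unfolding conn_image_eq[OF d] by (meson in_mono rtrancl_mono)
    have "ends G e = Upair (vs ! k) (vs ! (Suc k mod length es))"
      using c(1) k by (auto simp: cycle_def)
    \<comment> \<open>The pair \<open>d e\<close> may list the ends in either order; symmetry of
      \<open>conn\<close> covers both.\<close>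
    with d[of e] have "d e \<in> conn (d ` ?T S e)"
      using * conn_sym[OF *] by (cases "d e") auto
    moreover have "e \<in> edges G" using c(1,2) by (auto simp: cycle_def)
    ultimately show "\<exists>f\<in>edges G. d f \<in> conn (d ` ?T S f)" by blast
  next
    assume "\<exists>f\<in>edges G. d f \<in> conn (d ` ?T S f)"
    then obtain f where f: "f \<in> edges G" "d f \<in> conn (d ` ?T S f)" by blast
    obtain p q where pq: "d f = (p, q)" by fastforce
    have "(q, p) \<in> {(x, y). \<exists>g\<in>?T S f. ends G g = Upair x y}\<^sup>*"
      using f(2) pq conn_sym unfolding conn_image_eq[OF d, symmetric] by metis
    then have "\<exists>vs es. es \<noteq> [] \<and> length vs = length es \<and> distinct vs \<and> distinct es \<and>
        f \<in> set es \<and> set es \<subseteq> insert f (?T S f) \<and>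
        (\<forall>i<length es. ends G (es ! i) = Upair (vs ! i) (vs ! (Suc i mod length es)))"
      using d[of f] pq by (intro simple_cycle_through_edge) auto
    then obtain vs es where c: "es \<noteq> []" "length vs = length es" "distinct vs" "distinct es"
        "f \<in> set es" "set es \<subseteq> insert f (?T S f)"
        "\<forall>i<length es. ends G (es ! i) = Upair (vs ! i) (vs ! (Suc i mod length es))"
      by blast
    have "cycle G vs es"
      unfolding cycle_def using c f(1) S by blast
    moreover have "(f, g) \<in> r" if "g \<in> set es" for g
      using that c(6) r f(1) by (auto dest: refl_onD)
    ultimately have "broken_circuit G r (set es - {f})"
      unfolding broken_circuit_def using c(5) by blast
    moreover have "set es - {f} \<subseteq> S" using c(6) by blast
    ultimately show "\<exists>B. broken_circuit G r B \<and> B \<subseteq> S" by blast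
  qed
  then show ?thesis
    unfolding broken_circuit_complex_def nbc_def by blast
qed

text \<open>Acyclicity excludes loops, so an edge at \<open>v\<close> points to \<open>v\<close>
  exactly when \<open>v\<close> is not its tail.\<close>

lemma sinks_eq:
  assumes "\<omega> \<in> orientations G" "acyclic (\<omega> ` edges G)"
  shows "sinks G \<omega> = verts G - Domain (\<omega> ` edges G)"
proof -
  have ends: "ends G e = Upair (fst (\<omega> e)) (snd (\<omega> e))" if "e \<in> edges G" for e
    using assms(1) that by (fastforce simp: orientations_def PiE_iff)
  have no_loop: "fst (\<omega> e) \<noteq> snd (\<omega> e)" if "e \<in> edges G" for e
    using assms(2) that unfolding acyclic_def by (metis image_eqI prod.collapse trancl.r_into_trancl)
  have "(\<forall>e\<in>edges G. v \<in> set_uprod (ends G e) \<longrightarrow> snd (\<omega> e) = v) \<longleftrightarrow> v \<notin> Domain (\<omega> ` edges G)" for v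
  proof -
    have "v \<in> Domain (\<omega> ` edges G) \<longleftrightarrow> (\<exists>e\<in>edges G. fst (\<omega> e) = v)"
      by (simp add: Domain_fst image_iff) blast
    moreover have "v \<in> set_uprod (ends G e) \<longleftrightarrow> fst (\<omega> e) = v \<or> snd (\<omega> e) = v" if "e \<in> edges G" for e
      using ends[OF that] by auto
    ultimately show ?thesis using no_loop by metis
  qed
  then show ?thesis by (auto simp: sinks_def)
qed

text \<open>Reversing a loop changes nothing, so flipped sets determine orientations uniquely only
  without loops. The bijection is therefore made between acyclic ones; the remaining flipped sets
  have weight 0.\<close>

lemma acyclic_orientation_poly_eq_flip_sum:
  assumes fin: "finite (edges G)"
    and d: "\<And>e. Upair (fst (d e)) (snd (d e)) = ends G e"
  shows "acyclic_orientation_poly G =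
    (\<Sum>F\<in>Pow (edges G). orientation_weight (verts G) Var (flip d F ` edges G))"
proof -
  let ?E = "edges G" and ?V = "verts G"
  have ao: "acyclic_orientations G = {\<omega> \<in> orientations G. acyclic (\<omega> ` ?E)}"
    unfolding acyclic_orientations_def using directed_cycle_iff_not_acyclic by blast
  have ori: "\<omega> \<in> orientations G \<longleftrightarrow>
      \<omega> \<in> extensional ?E \<and> (\<forall>e\<in>?E. \<omega> e = d e \<or> \<omega> e = prod.swap (d e))" for \<omega>
  proof -
    have "(case p of (u, w) \<Rightarrow> Upair u w = ends G e) \<longleftrightarrow> p = d e \<or> p = prod.swap (d e)" for p e
      using d[of e, symmetric] by (cases p; cases "d e") auto
    then show ?thesis by (auto simp: orientations_def PiE_iff)
  qed
  have "acyclic_orientation_poly G =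
      (\<Sum>\<omega>\<in>{\<omega> \<in> orientations G. acyclic (\<omega> ` ?E)}. orientation_weight ?V Var (\<omega> ` ?E))"
    unfolding acyclic_orientation_poly_def ao
    by (intro sum.cong) (auto simp: orientation_weight_def sinks_eq)
  also have "\<dots> = (\<Sum>F\<in>{F \<in> Pow ?E. acyclic (flip d F ` ?E)}. orientation_weight ?V Var (flip d F ` ?E))"
  proof (rule sum.reindex_bij_witness[of _ "\<lambda>F. restrict (flip d F) ?E" "\<lambda>\<omega>. {e \<in> ?E. \<omega> e \<noteq> d e}"])
    fix \<omega> assume \<omega>: "\<omega> \<in> {\<omega> \<in> orientations G. acyclic (\<omega> ` ?E)}"
    then have "\<omega> e = d e \<or> \<omega> e = prod.swap (d e)" if "e \<in> ?E" for e
      using that by (simp add: ori)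
    then have eq: "flip d {e \<in> ?E. \<omega> e \<noteq> d e} e = \<omega> e" if "e \<in> ?E" for e
      using that unfolding flip_def by (metis (mono_tags, lifting) mem_Collect_eq)
    then have im: "flip d {e \<in> ?E. \<omega> e \<noteq> d e} ` ?E = \<omega> ` ?E"
      by (rule image_cong[OF refl])
    have "\<omega> \<in> extensional ?E" using \<omega> by (simp add: ori)
    then show "restrict (flip d {e \<in> ?E. \<omega> e \<noteq> d e}) ?E = \<omega>"
      using eq by (intro extensionalityI[of _ ?E]) simp_all
    show "{e \<in> ?E. \<omega> e \<noteq> d e} \<in> {F \<in> Pow ?E. acyclic (flip d F ` ?E)}"
      using \<omega> unfolding mem_Collect_eq[of _ "\<lambda>F. F \<in> Pow ?E \<and> acyclic (flip d F ` ?E)"] im by blast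
    show "orientation_weight ?V Var (flip d {e \<in> ?E. \<omega> e \<noteq> d e} ` ?E) =
        orientation_weight ?V Var (\<omega> ` ?E)"
      by (simp only: im)
  next
    fix F assume F: "F \<in> {F \<in> Pow ?E. acyclic (flip d F ` ?E)}"
    have "flip d F e \<noteq> d e" if "e \<in> F" for e
    proof
      assume "flip d F e = d e"
      moreover have "flip d F e = prod.swap (d e)" using that by (simp add: flip_def)
      ultimately have "fst (flip d F e) = snd (flip d F e)" by (metis fst_swap)
      moreover have "flip d F e \<in> flip d F ` ?E" using that F by blast
      ultimately show False
        using F unfolding acyclic_def
        by (metis (mono_tags, lifting) mem_Collect_eq prod.collapse trancl.r_into_trancl)
    qed
    then show "{e \<in> ?E. restrict (flip d F) ?E e \<noteq> d e} = F"
      using F by (auto simp: flip_def)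
    show "restrict (flip d F) ?E \<in> {\<omega> \<in> orientations G. acyclic (\<omega> ` ?E)}"
      using F by (auto simp: ori flip_def)
  qed
  also have "\<dots> = (\<Sum>F\<in>Pow ?E. orientation_weight ?V Var (flip d F ` ?E))"
    using fin by (intro sum.mono_neutral_left) (auto simp: orientation_weight_def)
  finally show ?thesis .
qed

lemma prod_component_poly_eq:
  assumes d: "\<And>e. Upair (fst (d e)) (snd (d e)) = ends G e"
  shows "(\<Prod>C\<in>components G S. component_poly C) = component_weight (verts G) Var (d ` S)"
proof -
  have "components G S = (\<lambda>p. {q \<in> verts G. (p, q) \<in> conn (d ` S)}) ` verts G"
    unfolding components_def quotient_def connected_in_def conn_image_eq[OF d] by blast
  then show ?thesis by (simp add: component_weight_def component_poly_def)
qed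

theorem theorem3p5:
  fixes G :: "('v, 'e) multigraph" and r :: "'e rel"
  assumes "finite_multigraph G"
    and "linear_order_on (edges G) r"
  shows "acyclic_orientation_poly G =
           (\<Sum>S\<in>broken_circuit_complex G r. \<Prod>C\<in>components G S. component_poly C)"
proof -
  let ?E = "edges G" and ?V = "verts G" and ?lt = "\<lambda>f g. (f, g) \<in> r \<and> f \<noteq> g"
  have fin: "finite ?V" "finite ?E" using assms(1) by (auto simp: finite_multigraph_def)
  have "\<exists>p. Upair (fst p) (snd p) = ends G e" for e
    by (cases "ends G e") auto
  \<comment> \<open>An arbitrary order of the ends of each edge, serving both as reference
    orientation and as edge list for connectivity.\<close>
  then obtain d where d: "\<And>e. Upair (fst (d e)) (snd (d e)) = ends G e" by metis
  have dV: "d ` ?E \<subseteq> ?V \<times> ?V"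
  proof
    fix p assume "p \<in> d ` ?E"
    then obtain e where e: "e \<in> ?E" "p = d e" by blast
    then have "set_uprod (Upair (fst p) (snd p)) \<subseteq> ?V"
      using assms(1) d by (simp add: finite_multigraph_def)
    then show "p \<in> ?V \<times> ?V" by (simp add: mem_Times_iff)
  qed
  have r: "refl_on ?E r" "antisym r" "trans r" "total_on ?E r"
    using assms(2) by (auto simp: linear_order_on_def partial_order_on_def preorder_on_def)
  have "asymp_on ?E ?lt" "transp_on ?E ?lt" "totalp_on ?E ?lt"
    using r(2-4)
    by (auto simp: asymp_on_def transp_on_def totalp_on_def total_on_def dest: antisymD transD)
  then have "acyclic_orientation_poly G =
      (\<Sum>S\<in>Pow ?E. if nbc ?lt d ?E S then component_weight ?V Var (d ` S) else 0)"
    unfolding acyclic_orientation_poly_eq_flip_sum[OF fin(2) d]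
    by (intro orientation_sum_eq_nbc_sum fin dV)
  also have "\<dots> = (\<Sum>S\<in>{S \<in> Pow ?E. nbc ?lt d ?E S}. component_weight ?V Var (d ` S))"
    using fin(2) by (subst sum.inter_filter) simp_all
  finally show ?thesis
    unfolding broken_circuit_complex_eq_nbc[OF d r(1)] prod_component_poly_eq[OF d] .
qed

end
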